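(* Let $n,k,\ell$ be positive integers. If there exists an $\mathrm{MS}(2,3,\mathbb{Z}_2^n\times\mathbb{Z}_{k+1}\times\mathbb{Z}_{\ell+1})$, then all of the following hold: (1) $n-k\equiv 0 \pmod 2$; (2) $n-\ell\equiv 0\pmod 2$; (3) $k\equiv \ell\equiv 1\pmod 2$; (4) $n\ge k\cdot \ell$; (5) $k\cdot\ell+(k+\ell)n+\binom{n}{2}\equiv 0\pmod 3$.
   Context: $\mathbb{Z}_q=\{0,1,\ldots,q-1\}$. For a mixed alphabet $Q=\mathbb{Z}_{q_1}\times\cdots\times\mathbb{Z}_{q_N}$ with all $q_i\ge 2$, the weight of a word in $Q$ is its number of nonzero coordinates, and $d(x,y)$ is the Hamming distance (the number of coordinates in which $x$ and $y$ differ). A mixed Steiner triple system $\mathrm{MS}(2,3,Q)$ is a set $\mathcal{C}\subseteq Q$ of words (codewords) of weight $3$ such that (i) for each word $x\in Q$ of weight $2$ there is exactly one $c\in\mathcal{C}$ that covers $x$, i.e. $d(x,c)=1$; and (ii) the minimum Hamming distance of $\mathcal{C}$ is $3$, meaning $d(c,c')\ge 3$ for all distinct $c,c'\in\mathcal{C}$. *)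

theory Defs
  imports Main "HOL-Number_Theory.Cong"
begin

text \<open>
  A mixed alphabet \<open>\<int>\<^sub>q\<^sub>1 \<times> \<dots> \<times> \<int>\<^sub>q\<^sub>N\<close> is given by the list \<open>[q1, \<dots>, qN]\<close>; the letters
  of the i-th coordinate are the natural numbers below \<open>qi\<close>.
\<close>

definition mixed_words :: "nat list \<Rightarrow> nat list set" where
  "mixed_words qs = {x. length x = length qs \<and> (\<forall>i<length qs. x ! i < qs ! i)}"

definition weight :: "nat list \<Rightarrow> nat" where
  "weight x = card {i. i < length x \<and> x ! i \<noteq> 0}"

text \<open>Only meaningful for words of equal length.\<close>

definition hamming_dist :: "nat list \<Rightarrow> nat list \<Rightarrow> nat" where
  "hamming_dist x y = card {i. i < length x \<and> x ! i \<noteq> y ! i}"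

definition covers :: "nat list \<Rightarrow> nat list \<Rightarrow> bool" where
  "covers c x \<longleftrightarrow> hamming_dist x c = 1"

text \<open>
  \<open>mixed_STS qs C\<close>: the set \<open>C\<close> is an \<open>MS(2,3,Q)\<close>, where \<open>Q\<close> is the mixed alphabet given by \<open>qs\<close>.
  Minimum distance 3 is read as a lower bound, so codes with at most one codeword are allowed.
\<close>

definition mixed_STS :: "nat list \<Rightarrow> nat list set \<Rightarrow> bool" where
  "mixed_STS qs C \<longleftrightarrow>
     (\<forall>q\<in>set qs. q \<ge> 2) \<and>
     C \<subseteq> mixed_words qs \<and>
     (\<forall>c\<in>C. weight c = 3) \<and>
     (\<forall>x\<in>mixed_words qs. weight x = 2 \<longrightarrow> (\<exists>!c. c \<in> C \<and> covers c x)) \<and>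
     (\<forall>c\<in>C. \<forall>c'\<in>C. c \<noteq> c' \<longrightarrow> hamming_dist c c' \<ge> 3)"

end

theory Submission
  imports Defs
begin

text \<open>
  Read a word of weight 2 or 3 as a set of points, a point being a coordinate together with a
  nonzero letter. The codewords are then triples covering every pair of points from different
  coordinates exactly once. Counting all such pairs gives (5), and counting the pairs through a
  fixed point shows that the number of points outside any given coordinate is even; for the two
  large coordinates and for a binary one this gives (1)--(3). For (4), the \<open>k * l\<close> pairs
  of points from the two large coordinates are completed by binary points, and by the distance
  condition no binary point is used twice.
\<close>

section \<open>Supports and words of fixed weight\<close>

definition support :: "nat list \<Rightarrow> nat set" where
  "support x = {i. i < length x \<and> x ! i \<noteq> 0}"

text \<open>For \<open>w = 1\<close> these are the points, for \<open>w = 2\<close> the pairs of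
  points from different coordinates.\<close>

definition weight_words :: "nat list \<Rightarrow> nat \<Rightarrow> nat list set" where
  "weight_words qs w = {x \<in> mixed_words qs. weight x = w}"

lemma finite_support [simp]: "finite (support x)"
  by (simp add: support_def)

lemma weight_eq_card_support: "weight x = card (support x)"
  by (simp add: weight_def support_def)

text \<open>This form computes along \<open>Cons\<close> and append;
  \<open>weight_eq_card_support\<close> is the one suited to list updates.\<close>

lemma weight_eq_filter: "weight x = length (filter (\<lambda>a. a \<noteq> 0) x)"
  by (simp add: weight_def length_filter_conv_card)

lemma mixed_words_iff: "x \<in> mixed_words qs \<longleftrightarrow> list_all2 (<) x qs"
  by (auto simp: mixed_words_def list_all2_conv_all_nth)

lemma length_mixed_word: "x \<in> mixed_words qs \<Longrightarrow> length x = length qs"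
  by (simp add: mixed_words_def)

lemma mixed_words_Cons:
  "mixed_words (q # qs) = (\<lambda>(a, x). a # x) ` ({..<q} \<times> mixed_words qs)"
  by (auto simp: mixed_words_iff list_all2_Cons2 image_iff)

lemma finite_mixed_words: "finite (mixed_words qs)"
proof (induction qs)
  case Nil
  then show ?case by (simp add: mixed_words_def)
next
  case (Cons q qs)
  then show ?case by (simp add: mixed_words_Cons)
qed

lemma finite_weight_words [simp]: "finite (weight_words qs w)"
  by (simp add: weight_words_def finite_mixed_words)

section \<open>Counting words of given weight\<close>

lemma weight_words_Nil: "weight_words [] w = (if w = 0 then {[]} else {})"
  by (auto simp: weight_words_def mixed_words_iff weight_eq_filter)

lemma card_weight_words_0:
  assumes "\<forall>q\<in>set qs. q > 0"
  shows "card (weight_words qs 0) = 1"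
proof -
  have "weight_words qs 0 = {replicate (length qs) 0}"
    using assms
    by (auto simp: weight_words_def mixed_words_def weight_eq_filter filter_empty_conv
        intro!: nth_equalityI)
  then show ?thesis by simp
qed

text \<open>Split by the first letter: either it is zero and the tail carries the whole weight, or
  it is one of \<open>q - 1\<close> nonzero letters.\<close>

lemma card_weight_words_Cons:
  assumes "q > 0"
  shows "card (weight_words (q # qs) (Suc w)) =
    card (weight_words qs (Suc w)) + (q - 1) * card (weight_words qs w)"
proof -
  let ?A = "(#) 0 ` weight_words qs (Suc w)"
  let ?B = "(\<lambda>(a, x). a # x) ` ({0<..<q} \<times> weight_words qs w)"
  have "weight_words (q # qs) (Suc w) = ?A \<union> ?B"
  proof (rule set_eqI)
    fix x
    show "x \<in> weight_words (q # qs) (Suc w) \<longleftrightarrow> x \<in> ?A \<union> ?B"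
      using assms
      by (cases x) (auto simp: weight_words_def mixed_words_iff weight_eq_filter image_iff)
  qed
  moreover have "card (?A \<union> ?B) = card ?A + card ?B"
    by (intro card_Un_disjoint) auto
  moreover have "card ?A = card (weight_words qs (Suc w))"
    by (intro card_image) (auto simp: inj_on_def)
  moreover have "card ?B = (q - 1) * card (weight_words qs w)"
    by (subst card_image) (auto simp: inj_on_def card_cartesian_product)
  ultimately show ?thesis by simp
qed

lemma card_weight_words_1:
  assumes "\<forall>q\<in>set qs. q > 0"
  shows "card (weight_words qs 1) = (\<Sum>q\<leftarrow>qs. q - 1)"
  using assms
  by (induction qs)
    (simp_all add: weight_words_Nil card_weight_words_Cons card_weight_words_0)

text \<open>Deleting the coordinate that holds \<open>a\<close> is a bijection, with reinsertion of
  \<open>a\<close> as inverse. For \<open>w = 1\<close> this counts the pairs through a fixed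
  point.\<close>

lemma card_weight_words_fixed_letter:
  assumes "0 < a" and "a < q"
  shows "card {x \<in> weight_words (ps @ q # qs) (Suc w). x ! length ps = a} =
    card (weight_words (ps @ qs) w)"
proof -
  let ?p = "length ps"
  let ?f = "\<lambda>y. take ?p y @ a # drop ?p y"
  have "bij_betw ?f (weight_words (ps @ qs) w)
    {x \<in> weight_words (ps @ q # qs) (Suc w). x ! ?p = a}"
  proof (rule bij_betw_byWitness[where f' = "\<lambda>x. take ?p x @ drop (Suc ?p) x"])
    show "?f ` weight_words (ps @ qs) w
      \<subseteq> {x \<in> weight_words (ps @ q # qs) (Suc w). x ! ?p = a}"
    proof (rule image_subsetI)
      fix y assume "y \<in> weight_words (ps @ qs) w"
      then obtain u v where "y = u @ v" "length u = ?p" "list_all2 (<) u ps" "list_all2 (<) v qs"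
        "weight (u @ v) = w"
        by (auto simp: weight_words_def mixed_words_iff list_all2_append2)
      then show "?f y \<in> {x \<in> weight_words (ps @ q # qs) (Suc w). x ! ?p = a}"
        using assms
        by (simp add: weight_words_def mixed_words_iff weight_eq_filter list_all2_append
            nth_append)
    qed
    show "(\<lambda>x. take ?p x @ drop (Suc ?p) x) `
        {x \<in> weight_words (ps @ q # qs) (Suc w). x ! ?p = a} \<subseteq> weight_words (ps @ qs) w"
    proof (rule image_subsetI)
      fix x assume "x \<in> {x \<in> weight_words (ps @ q # qs) (Suc w). x ! ?p = a}"
      then obtain u v where "x = u @ a # v" "length u = ?p" "list_all2 (<) u ps"
        "list_all2 (<) v qs" "weight (u @ a # v) = Suc w"
        by (auto simp: weight_words_def mixed_words_iff list_all2_append2 list_all2_Cons2 nth_append)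
      then show "take ?p x @ drop (Suc ?p) x \<in> weight_words (ps @ qs) w"
        using assms
        by (simp add: weight_words_def mixed_words_iff weight_eq_filter list_all2_append)
    qed
    show "\<forall>y\<in>weight_words (ps @ qs) w. take ?p (?f y) @ drop (Suc ?p) (?f y) = y"
      by (auto simp: weight_words_def mixed_words_iff list_all2_append2)
    show "\<forall>x\<in>{x \<in> weight_words (ps @ q # qs) (Suc w). x ! ?p = a}.
        ?f (take ?p x @ drop (Suc ?p) x) = x"
      by (auto simp: weight_words_def mixed_words_iff list_all2_append2 list_all2_Cons2
          nth_append)
  qed
  then show ?thesis by (simp add: bij_betw_same_card)
qed

section \<open>Covering as erasure of one letter\<close>

lemma support_update:
  assumes "i < length x"
  shows "support (x[i := a]) = (if a = 0 then support x - {i} else insert i (support x))"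
  using assms by (auto simp: support_def nth_list_update split: if_splits)

lemma covers_erase:
  assumes "i \<in> support c"
  shows "covers c (c[i := 0])"
proof -
  have "{j. j < length c \<and> c[i := 0] ! j \<noteq> c ! j} = {i}"
    using assms by (auto simp: support_def nth_list_update split: if_splits)
  then show ?thesis by (simp add: covers_def hamming_dist_def)
qed

lemma weight_erase:
  assumes "i \<in> support c"
  shows "Suc (weight (c[i := 0])) = weight c"
proof -
  have "i < length c" using assms by (simp add: support_def)
  then show ?thesis
    using card.remove[OF finite_support assms]
    by (simp add: weight_eq_card_support support_update)
qed

lemma erase_mixed_word:
  assumes "c \<in> mixed_words qs"
  shows "c[i := 0] \<in> mixed_words qs"
  unfolding mixed_words_def
proof (intro CollectI conjI allI impI)
  show "length (c[i := 0]) = length qs" using assms by (simp add: mixed_words_def)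
  fix j assume "j < length qs"
  then have "c ! j < qs ! j" and "length c = length qs"
    using assms by (auto simp: mixed_words_def)
  then show "c[i := 0] ! j < qs ! j"
    using \<open>j < length qs\<close> by (cases "j = i") auto
qed

text \<open>The words differ in a single coordinate. A nonzero letter of \<open>x\<close> there
  would make the support of \<open>x\<close> contain that of \<open>c\<close>, against the
  weights.\<close>

lemma covers_imp_erase:
  assumes "covers c x" and len: "length x = length c" and w: "weight x < weight c"
  obtains i where "i \<in> support c" "x = c[i := 0]"
proof -
  obtain i where i: "{j. j < length x \<and> x ! j \<noteq> c ! j} = {i}"
    using assms(1) by (auto simp: covers_def hamming_dist_def card_1_singleton_iff)
  then have il: "i < length c" using len by auto
  have agree: "x ! j = c ! j" if "j < length c" "j \<noteq> i" for j
  proof -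
    have "j \<notin> {j. j < length x \<and> x ! j \<noteq> c ! j}" using that by (simp add: i)
    then show ?thesis using that len by simp
  qed
  define a where "a = x ! i"
  have x: "x = c[i := a]"
    using agree len il by (intro nth_equalityI) (auto simp: nth_list_update a_def)
  have "a = 0"
  proof (rule ccontr)
    assume "a \<noteq> 0"
    then have "support x = insert i (support c)"
      by (simp add: x support_update[OF il])
    then have "weight c \<le> weight x"
      by (auto simp: weight_eq_card_support intro: card_mono)
    then show False using w by simp
  qed
  moreover have "i \<in> support c"
  proof -
    have "i \<in> {j. j < length x \<and> x ! j \<noteq> c ! j}" by (simp add: i)
    then show ?thesis using len \<open>a = 0\<close> by (simp add: support_def a_def)
  qed
  ultimately show thesis using that x by simp
qed

lemma covered_words:
  assumes "c \<in> mixed_words qs" and "weight c = Suc w"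
  shows "{x \<in> weight_words qs w. covers c x} = (\<lambda>i. c[i := 0]) ` support c"
proof (intro equalityI subsetI)
  fix x assume "x \<in> {x \<in> weight_words qs w. covers c x}"
  then show "x \<in> (\<lambda>i. c[i := 0]) ` support c"
    using assms
    by (auto simp: weight_words_def length_mixed_word elim!: covers_imp_erase[of c x])
next
  fix x assume "x \<in> (\<lambda>i. c[i := 0]) ` support c"
  then obtain i where "i \<in> support c" "x = c[i := 0]" by blast
  then show "x \<in> {x \<in> weight_words qs w. covers c x}"
    using assms weight_erase[of i c] erase_mixed_word[OF assms(1), of i] covers_erase[of i c]
    by (simp add: weight_words_def)
qed

text \<open>The erased coordinate can be read off from the support that remains. With
  \<open>covered_words\<close>, a codeword therefore covers exactly three words of weight 2.\<close>

lemma inj_on_erase: "inj_on (\<lambda>i. c[i := 0]) (support c)"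
proof (rule inj_onI)
  fix i j assume "i \<in> support c" "j \<in> support c" and eq: "c[i := 0] = c[j := 0]"
  then have "support c - {i} = support c - {j}"
    using support_update[of i c 0] support_update[of j c 0] by (auto simp: support_def)
  then show "i = j" using \<open>i \<in> support c\<close> \<open>j \<in> support c\<close> by blast
qed

section \<open>Double counting of covered pairs\<close>

lemma mixed_STS_card_covering:
  assumes "mixed_STS qs C" and "x \<in> weight_words qs 2"
  shows "card {c \<in> C. covers c x} = 1"
proof -
  have "\<exists>!c. c \<in> C \<and> covers c x"
    using assms by (auto simp: mixed_STS_def weight_words_def)
  then show ?thesis by (auto simp: card_1_singleton_iff)
qed

lemma mixed_STS_codeword:
  assumes "mixed_STS qs C" and "c \<in> C"
  shows "c \<in> mixed_words qs" and "weight c = Suc 2"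
  using assms by (auto simp: mixed_STS_def)

lemma mixed_STS_finite:
  assumes "mixed_STS qs C"
  shows "finite C"
  using assms finite_subset[OF _ finite_mixed_words] by (auto simp: mixed_STS_def)

text \<open>Count the incidences between words of weight 2 and codewords: each word lies in one,
  each codeword in three.\<close>

lemma mixed_STS_card:
  assumes "mixed_STS qs C"
  shows "card (weight_words qs 2) = 3 * card C"
proof -
  have "(\<Sum>x\<in>weight_words qs 2. card {c \<in> C. covers c x}) = 3 * card C"
  proof (rule sum_multicount)
    show "\<forall>c\<in>C. card {x \<in> weight_words qs 2. covers c x} = 3"
      using mixed_STS_codeword[OF assms]
      by (simp add: covered_words card_image inj_on_erase flip: weight_eq_card_support)
  qed (simp_all add: mixed_STS_finite[OF assms])
  then show ?thesis by (simp add: mixed_STS_card_covering[OF assms])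
qed

text \<open>Fix the point with letter 1 at coordinate \<open>length ps\<close>. The sum counts the
  pairs through it, and the codewords through it group these pairs in twos.\<close>

lemma mixed_STS_degree_even:
  assumes sts: "mixed_STS (ps @ q # qs) C"
  shows "even ((\<Sum>p\<leftarrow>ps. p - 1) + (\<Sum>p\<leftarrow>qs. p - 1))"
proof -
  \<comment> \<open>Letter 1 exists because \<open>q\<close> is at least 2. Writing
    \<open>Suc 1\<close> matches \<open>card_weight_words_fixed_letter\<close>.\<close>
  define W where "W = {x \<in> weight_words (ps @ q # qs) (Suc 1). x ! length ps = 1}"
  define D where "D = {c \<in> C. c ! length ps = 1}"
  have big: "\<forall>p\<in>set (ps @ q # qs). p \<ge> 2" using sts by (simp add: mixed_STS_def)
  have "finite W" "finite D" using mixed_STS_finite[OF sts] by (auto simp: W_def D_def)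
  have fibre: "card {x \<in> W. covers c x} = 2" if "c \<in> D" for c
  proof -
    have c: "c \<in> mixed_words (ps @ q # qs)" "weight c = Suc 2" "c ! length ps = 1"
      using that mixed_STS_codeword[OF sts] by (auto simp: D_def)
    then have p: "length ps \<in> support c" by (simp add: support_def mixed_words_def)
    have "{x \<in> W. covers c x} =
        {x \<in> {x \<in> weight_words (ps @ q # qs) 2. covers c x}. x ! length ps = 1}"
      by (auto simp: W_def numeral_2_eq_2)
    \<comment> \<open>Of the three erasures, only the one at \<open>length ps\<close> destroys the
      fixed letter.\<close>
    also have "\<dots> = (\<lambda>i. c[i := 0]) ` (support c - {length ps})"
      unfolding covered_words[OF c(1,2)]
      using c(3) by (auto simp: support_def nth_list_update split: if_splits)
    finally have "card {x \<in> W. covers c x} = card (support c - {length ps})"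
      by (simp add: card_image inj_on_subset[OF inj_on_erase])
    then show ?thesis using p c(2) by (simp add: weight_eq_card_support)
  qed
  have cover: "card {c \<in> D. covers c x} = 1" if "x \<in> W" for x
  proof -
    have x: "x \<in> weight_words (ps @ q # qs) 2" "x ! length ps = 1"
      using that by (auto simp: W_def numeral_2_eq_2)
    \<comment> \<open>Since \<open>x\<close> arises from \<open>c\<close> by writing a zero, its
      letter 1 must already stand in \<open>c\<close>.\<close>
    have "c ! length ps = 1" if "c \<in> C" "covers c x" for c
    proof -
      have "x \<in> (\<lambda>i. c[i := 0]) ` support c"
        using covered_words[OF mixed_STS_codeword[OF sts \<open>c \<in> C\<close>]] x \<open>covers c x\<close> by blast
      then show ?thesis using x(2)
        by (auto simp: support_def nth_list_update split: if_splits)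
    qed
    then have "{c \<in> D. covers c x} = {c \<in> C. covers c x}" by (auto simp: D_def)
    then show ?thesis using mixed_STS_card_covering[OF sts x(1)] by simp
  qed
  have "(\<Sum>x\<in>W. card {c \<in> D. covers c x}) = 2 * card D"
    using \<open>finite W\<close> \<open>finite D\<close> fibre by (intro sum_multicount) auto
  then have "card W = 2 * card D" by (simp add: cover)
  moreover have "card W = card (weight_words (ps @ qs) 1)"
    unfolding W_def using big by (intro card_weight_words_fixed_letter) auto
  moreover have "card (weight_words (ps @ qs) 1) = (\<Sum>p\<leftarrow>ps @ qs. p - 1)"
    using big by (intro card_weight_words_1) force
  ultimately show ?thesis by (metis dvd_triv_left map_append sum_list_append)
qed

section \<open>The lower bound on the number of binary coordinates\<close>

lemma mixed_STS_mult_le: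
  assumes sts: "mixed_STS (replicate n 2 @ [k + 1, l + 1]) C"
  shows "k * l \<le> n"
proof -
  let ?qs = "replicate n 2 @ [k + 1, l + 1]"
  let ?w = "\<lambda>i a b. (replicate n 0)[i := Suc 0] @ [a, b]"
  have "\<exists>i<n. ?w i a b \<in> C" if "a \<in> {1..k}" "b \<in> {1..l}" for a b
  proof -
    let ?x = "replicate n 0 @ [a, b]"
    have "list_all2 (<) (replicate n (0::nat)) (replicate n 2)"
      by (simp add: list_all2_conv_all_nth)
    then have "?x \<in> mixed_words ?qs"
      unfolding mixed_words_iff using that by (intro list_all2_appendI) auto
    moreover have "weight ?x = 2"
      using that by (simp add: weight_eq_filter)
    ultimately obtain c where c: "c \<in> C" "covers c ?x" using sts unfolding mixed_STS_def by meson
    have cw: "c \<in> mixed_words ?qs" "weight c = 3"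
      using mixed_STS_codeword[OF sts c(1)] by auto
    then obtain i where i: "i \<in> support c" "?x = c[i := 0]"
      using covers_imp_erase[OF c(2)] \<open>weight ?x = 2\<close> by (auto simp: length_mixed_word)
    have "length c = n + 2" using cw by (simp add: length_mixed_word)
    have at: "?x ! j = (if j = i then 0 else c ! j)" if "j < n + 2" for j
      using that \<open>length c = n + 2\<close> by (simp add: i(2) nth_list_update)
    \<comment> \<open>The last two letters of \<open>?x\<close> are nonzero, so neither of them was
      erased from \<open>c\<close>.\<close>
    have "i < n"
      using at[of n] at[of "Suc n"] \<open>a \<in> _\<close> \<open>b \<in> _\<close> i(1) \<open>length c = n + 2\<close>
      by (auto simp: support_def nth_append split: if_splits)
    \<comment> \<open>A binary coordinate has only one nonzero letter.\<close>
    moreover have "c ! i = 1"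
    proof -
      have "c ! i < ?qs ! i" using cw(1) \<open>i < n\<close> by (auto simp: mixed_words_def)
      then show ?thesis using i(1) \<open>i < n\<close> by (simp add: support_def nth_append)
    qed
    moreover have "c = ?x[i := c ! i]" using i by simp
    ultimately have "c = ?w i a b" by (simp add: list_update_append)
    then show ?thesis using c(1) \<open>i < n\<close> by blast
  qed
  \<comment> \<open>Here \<open>f a b\<close> is the binary coordinate that completes the pair
    \<open>a\<close>, \<open>b\<close> to a codeword.\<close>
  then have "\<exists>f. \<forall>a\<in>{1..k}. \<forall>b\<in>{1..l}. f a b < n \<and> ?w (f a b) a b \<in> C"
    by metis
  then obtain f where f: "\<And>a b. a \<in> {1..k} \<Longrightarrow> b \<in> {1..l} \<Longrightarrow> f a b < n \<and> ?w (f a b) a b \<in> C"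
    by blast
  have "inj_on (\<lambda>(a, b). f a b) ({1..k} \<times> {1..l})"
  proof (rule inj_onI, clarify)
    fix a b a' b'
    assume ab: "a \<in> {1..k}" "b \<in> {1..l}" "a' \<in> {1..k}" "b' \<in> {1..l}" and eq: "f a b = f a' b'"
    let ?c = "?w (f a b) a b" and ?c' = "?w (f a b) a' b'"
    \<comment> \<open>Equal values of \<open>f\<close> give equal binary parts, so the two codewords
      can differ only in the last two coordinates. Minimum distance 3 then forces them to
      coincide.\<close>
    have "{i. i < length ?c \<and> ?c ! i \<noteq> ?c' ! i} \<subseteq> {n, Suc n}"
      by (auto simp: nth_append)
    from card_mono[OF _ this] have "hamming_dist ?c ?c' \<le> 2"
      by (simp add: hamming_dist_def)
    moreover have "?c \<in> C" "?c' \<in> C" using f[OF ab(1,2)] f[OF ab(3,4)] eq by auto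
    ultimately have "?c = ?c'"
      using sts unfolding mixed_STS_def by (metis not_less_eq_eq numeral_2_eq_2 numeral_3_eq_3)
    then show "a = a' \<and> b = b'" by simp
  qed
  moreover have "(\<lambda>(a, b). f a b) ` ({1..k} \<times> {1..l}) \<subseteq> {..<n}" using f by auto
  ultimately have "card ({1..k} \<times> {1..l}) \<le> card {..<n}"
    by (intro card_inj_on_le) auto
  then show ?thesis by (simp add: card_cartesian_product)
qed

section \<open>The number of pairs, and the necessary conditions\<close>

lemma card_weight_words_2:
  "card (weight_words (replicate n 2 @ [k + 1, l + 1]) 2) = k * l + (k + l) * n + (n choose 2)"
proof (induction n)
  case 0
  show ?case
    by (simp add: numeral_2_eq_2 card_weight_words_Cons weight_words_Nil card_weight_words_0)
next
  case (Suc n)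
  \<comment> \<open>A further binary coordinate adds one pair for each old point; the summand
    \<open>n\<close> turns \<open>n choose 2\<close> into \<open>Suc n choose 2\<close>.\<close>
  have "card (weight_words (replicate n 2 @ [k + 1, l + 1]) 1) = n + k + l"
    by (subst card_weight_words_1) (auto simp: sum_list_replicate)
  then show ?case
    using Suc card_weight_words_Cons[of 2 "replicate n 2 @ [k + 1, l + 1]" 1]
    by (simp add: numeral_2_eq_2 algebra_simps)
qed

theorem lemma2:
  fixes n k l :: nat
  assumes "n > 0" and "k > 0" and "l > 0"
    and "\<exists>C. mixed_STS (replicate n 2 @ [k + 1, l + 1]) C"
  shows "[int n - int k = 0] (mod 2)
    \<and> [int n - int l = 0] (mod 2)
    \<and> ([k = l] (mod 2) \<and> [l = 1] (mod 2))
    \<and> n \<ge> k * l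
    \<and> [k * l + (k + l) * n + (n choose 2) = 0] (mod 3)"
proof -
  obtain C where sts: "mixed_STS (replicate n 2 @ [k + 1, l + 1]) C" using assms(4) by blast
  \<comment> \<open>Positivity of \<open>n\<close> provides a binary coordinate to which
    \<open>mixed_STS_degree_even\<close> applies; \<open>m\<close> counts the other binary
    ones.\<close>
  obtain m where n: "n = Suc m" using assms(1) by (cases n) auto
  have nl: "even (n + l)"
    using mixed_STS_degree_even[of "replicate n 2" "k + 1" "[l + 1]"] sts
    by (simp add: sum_list_replicate)
  have nk: "even (n + k)"
    using mixed_STS_degree_even[of "replicate n 2 @ [k + 1]" "l + 1" "[]"] sts
    by (simp add: sum_list_replicate)
  have "even (m + k + l)"
    using mixed_STS_degree_even[of "[]" 2 "replicate m 2 @ [k + 1, l + 1]"] sts n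
    by (simp add: sum_list_replicate add.assoc)
  \<comment> \<open>By \<open>nl\<close> and \<open>nk\<close>, all of \<open>n\<close>,
    \<open>k\<close>, \<open>l\<close> have the same parity, so \<open>k + l\<close> is even. Hence
    \<open>m\<close> is even and \<open>n = Suc m\<close> is odd.\<close>
  then have "odd k" "odd l" "odd n" using nl nk n by (auto split: if_splits)
  then have "[int n - int k = 0] (mod 2)" "[int n - int l = 0] (mod 2)"
    "[k = l] (mod 2)" "[l = 1] (mod 2)"
    by (simp_all add: cong_0_iff) (simp_all add: cong_def odd_iff_mod_2_eq_one)
  moreover have "[k * l + (k + l) * n + (n choose 2) = 0] (mod 3)"
    using mixed_STS_card[OF sts] unfolding card_weight_words_2 by (simp add: cong_0_iff)
  ultimately show ?thesis using mixed_STS_mult_le[OF sts] by blast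
qed

end
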